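(* Let $\mathcal{C}$ be a self-dual $\mathbb{Z}_4$-code of length $24$ and minimum Lee weight $10$. Then $\mathcal{C}$ is a Type I $\mathbb{Z}_4$-code having minimum Euclidean weight $12$.
   Context: A $\mathbb{Z}_4$-code of length $n$ is a $\mathbb{Z}_4$-submodule $\mathcal{C}$ of $\mathbb{Z}_4^n$, where $\mathbb{Z}_4=\{0,1,2,3\}$ is the ring of integers modulo $4$. Its dual is $\mathcal{C}^\perp=\{x\in\mathbb{Z}_4^n \mid x\cdot y=0 \text{ for all } y\in\mathcal{C}\}$, with $x\cdot y$ the standard inner product; $\mathcal{C}$ is self-dual if $\mathcal{C}=\mathcal{C}^\perp$. For $x\in\mathbb{Z}_4^n$ let $n_i(x)$ be the number of components of $x$ equal to $i$. The Lee weight of $x$ is $n_1(x)+2n_2(x)+n_3(x)$ and the Euclidean weight of $x$ is $n_1(x)+4n_2(x)+n_3(x)$. The minimum Lee (resp. Euclidean) weight of $\mathcal{C}$ is the smallest Lee (resp. Euclidean) weight among all non-zero codewords of $\mathcal{C}$. A self-dual $\mathbb{Z}_4$-code is Type II if the Euclidean weights of all its codewords are divisible by $8$, and Type I if it is self-dual but not Type II. *)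

theory Defs
  imports "HOL-Analysis.Analysis" "HOL-Library.Numeral_Type"
begin

text \<open>
  The numeral type \<open>4\<close> of \<open>HOL-Library.Numeral_Type\<close> has exactly four elements, and its
  ring operations are those of the integers modulo 4.
\<close>

type_synonym z4 = "4"

text \<open>Over a commutative ring \<^const>\<open>module.subspace\<close> is the notion of a submodule.\<close>

definition z4_code :: "(z4 ^ 'n) set \<Rightarrow> bool" where
  "z4_code C \<longleftrightarrow> module.subspace ((*s) :: z4 \<Rightarrow> z4 ^ 'n \<Rightarrow> z4 ^ 'n) C"

lemma module_vector_scalar_mult:
  "module ((*s) :: 'a::comm_ring_1 \<Rightarrow> 'a ^ 'n \<Rightarrow> 'a ^ 'n)"
  by unfold_locales (simp_all add: vec_eq_iff algebra_simps)

lemma z4_code_iff: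
  "z4_code C \<longleftrightarrow>
     0 \<in> C \<and> (\<forall>x\<in>C. \<forall>y\<in>C. x + y \<in> C) \<and> (\<forall>c. \<forall>x\<in>C. c *s x \<in> C)"
  unfolding z4_code_def module.subspace_def[OF module_vector_scalar_mult] ..

definition dual_code :: "(z4 ^ 'n) set \<Rightarrow> (z4 ^ 'n) set" where
  "dual_code C = {x. \<forall>y\<in>C. scalar_product x y = 0}"

definition self_dual :: "(z4 ^ 'n) set \<Rightarrow> bool" where
  "self_dual C \<longleftrightarrow> z4_code C \<and> C = dual_code C"

definition num_comps :: "z4 \<Rightarrow> z4 ^ 'n \<Rightarrow> nat" where
  "num_comps a x = card {i. x $ i = a}"

definition lee_weight :: "z4 ^ 'n \<Rightarrow> nat" where
  "lee_weight x = num_comps 1 x + 2 * num_comps 2 x + num_comps 3 x"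

definition euclidean_weight :: "z4 ^ 'n \<Rightarrow> nat" where
  "euclidean_weight x = num_comps 1 x + 4 * num_comps 2 x + num_comps 3 x"

text \<open>
  The set of codewords is finite; the minimum weights are meaningful for every code with a
  non-zero codeword, in particular for every self-dual code of positive length.
\<close>

definition min_lee_weight :: "(z4 ^ 'n) set \<Rightarrow> nat" where
  "min_lee_weight C = Min (lee_weight ` (C - {0}))"

definition min_euclidean_weight :: "(z4 ^ 'n) set \<Rightarrow> nat" where
  "min_euclidean_weight C = Min (euclidean_weight ` (C - {0}))"

definition type_II :: "(z4 ^ 'n) set \<Rightarrow> bool" where
  "type_II C \<longleftrightarrow> self_dual C \<and> (\<forall>x\<in>C. 8 dvd euclidean_weight x)"

definition type_I :: "(z4 ^ 'n) set \<Rightarrow> bool" where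
  "type_I C \<longleftrightarrow> self_dual C \<and> \<not> type_II C"

end

theory Submission
  imports Defs
begin

text \<open>
  Euclidean weights in \<open>C\<close> are multiples of 4, so they are at least 12 off zero, and a codeword of
  Euclidean weight 12 shows at once that \<open>C\<close> is not of Type II. Doubling a codeword shows that its
  number of odd entries is 0 or at least 8. A codeword of Lee weight 10 therefore has either eight
  odd entries and one 2, hence Euclidean weight 12, or five 2s and no odd entry; in the latter case
  self-duality forbids a codeword with all entries odd.

  In that case suppose that there is no codeword of Euclidean weight 12. For a codeword \<open>x\<close> sum the
  character \<open>\<epsilon>(x, d) = (-1)^#{i. x $ i = 2, d $ i odd}\<close> over the codewords \<open>d\<close> that are even wherever
  \<open>x\<close> is odd. By self-duality such sums detect codewords with the same odd positions as \<open>x\<close> and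
  prescribed 2s. Let \<open>Z\<close> be the number of even codewords. If \<open>x\<close> has 8 odd entries, then the sum of
  \<open>\<epsilon>(x, d)\<close> over the \<open>d\<close> with 12 odd entries is \<open>2 Z\<close>; if \<open>x\<close> has 12 odd entries, then the sum over
  the \<open>d\<close> with 8 odd entries is \<open>- Z\<close>. As \<open>\<epsilon>\<close> is symmetric on these pairs, counting them twice shows
  that neither kind of codeword exists. But if \<open>y\<close> has \<open>w y\<close> odd entries, then \<open>(24 - 2 w y)\<^sup>2\<close> averages
  to 24 over \<open>C\<close>, which forces a codeword with 12 odd entries.
\<close>

section \<open>Parity and sign characters of words over \<open>z4\<close>\<close>

lemma z4_cases: "(a::z4) = 0 \<or> a = 1 \<or> a = 2 \<or> a = 3"
  using exhaust_4[of a] by auto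

lemma z4_all: "(\<forall>a::z4. P a) \<longleftrightarrow> P 0 \<and> P 1 \<and> P 2 \<and> P 3"
  by (metis z4_cases)

lemma of_nat_z4_eq_0_iff: "(of_nat k :: z4) = 0 \<longleftrightarrow> 4 dvd k"
  by (simp add: of_nat_eq_0_iff_char_dvd)

text \<open>An element \<open>a\<close> of \<^typ>\<open>z4\<close> is odd if and only if \<open>2 * a \<noteq> 0\<close>.\<close>

definition z4_sign :: "z4 \<Rightarrow> int" where
  "z4_sign a = (if 2 * a = 0 then 1 else - 1)"

text \<open>Only the parities of \<open>g\<close> and \<open>y\<close> matter, so this is a
  character of the code modulo 2. Keeping \<open>g\<close> over \<open>z4\<close> makes
  \<open>2 *s g\<close> available as a candidate codeword.\<close>

definition z4_char :: "z4 ^ 'n \<Rightarrow> z4 ^ 'n \<Rightarrow> int" where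
  "z4_char g y = z4_sign (scalar_product g y)"

definition odd_supp :: "z4 ^ 'n \<Rightarrow> 'n set" where
  "odd_supp x = {i. 2 * x $ i \<noteq> 0}"

definition even_on :: "'n set \<Rightarrow> (z4 ^ 'n) set \<Rightarrow> (z4 ^ 'n) set" where
  "even_on A C = {y \<in> C. odd_supp y \<inter> A = {}}"

text \<open>\<open>z4_char (twos x) d\<close> is the character \<epsilon>(x, d) of the overview.
  Moreover \<open>2 *s twos x\<close> cancels the 2s of \<open>x\<close>, since 2 + 2 = 0.\<close>

definition twos :: "z4 ^ 'n \<Rightarrow> z4 ^ 'n" where
  "twos x = (\<chi> i. if x $ i = 2 then 1 else 0)"

lemma z4_sign_add: "z4_sign (a + b) = z4_sign a * z4_sign b"
proof -
  have "\<forall>a b. z4_sign (a + b) = z4_sign a * z4_sign b"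
    unfolding z4_all z4_sign_def by simp
  then show ?thesis by blast
qed

lemma z4_sign_cases: "z4_sign a = 1 \<or> z4_sign a = - 1"
  by (simp add: z4_sign_def)

lemma scalar_product_add_left:
  "scalar_product (g + h) y = scalar_product g y + scalar_product h (y :: 'a::semiring_1 ^ 'n)"
  by (simp add: scalar_product_def distrib_right sum.distrib)

lemma scalar_product_add_right:
  "scalar_product g (x + y) = scalar_product g x + scalar_product g (y :: 'a::semiring_1 ^ 'n)"
  by (simp add: scalar_product_def distrib_left sum.distrib)

lemma scalar_product_scale_left:
  "scalar_product (c *s g) y = c * scalar_product g (y :: 'a::semiring_1 ^ 'n)"
  by (simp add: scalar_product_def sum_distrib_left mult.assoc)

lemma scalar_product_axis_left:
  "scalar_product (axis i 1) y = (y :: 'a::semiring_1 ^ 'n) $ i"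
proof -
  have "scalar_product (axis i 1) y = (\<Sum>j\<in>UNIV. if j = i then y $ j else 0)"
    unfolding scalar_product_def by (rule sum.cong) (auto simp: axis_def)
  then show ?thesis by simp
qed

lemma z4_char_add_left: "z4_char (g + h) y = z4_char g y * z4_char h y"
  by (simp add: z4_char_def scalar_product_add_left z4_sign_add)

lemma z4_char_add_right: "z4_char g (x + y) = z4_char g x * z4_char g y"
  by (simp add: z4_char_def scalar_product_add_right z4_sign_add)

lemma z4_char_axis: "z4_char (axis i 1) y = (if i \<in> odd_supp y then - 1 else 1)"
  by (simp add: z4_char_def scalar_product_axis_left z4_sign_def odd_supp_def)

lemma z4_char_cases: "z4_char g y = 1 \<or> z4_char g y = - 1"
  by (simp add: z4_char_def z4_sign_cases)

lemma odd_supp_add: "odd_supp (x + y) = (odd_supp x - odd_supp y) \<union> (odd_supp y - odd_supp x)"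
proof -
  have "\<forall>a b::z4. 2 * (a + b) \<noteq> 0 \<longleftrightarrow> (2 * a \<noteq> 0) \<noteq> (2 * b \<noteq> 0)"
    unfolding z4_all by simp
  then show ?thesis by (auto simp: odd_supp_def)
qed

lemma odd_supp_scale: "odd_supp (c *s x) \<subseteq> odd_supp x"
  by (auto simp: odd_supp_def mult.left_commute)

lemma odd_supp_double [simp]: "odd_supp (2 *s x) = {}"
proof -
  have "\<forall>a::z4. 2 * (2 * a) = 0" unfolding z4_all by simp
  then show ?thesis by (auto simp: odd_supp_def)
qed

lemma odd_supp_axis [simp]: "odd_supp (axis i 1) = {i}"
  by (auto simp: odd_supp_def axis_def)

section \<open>Character sums over a submodule\<close>

lemma z4_codeD:
  assumes "z4_code C"
  shows "0 \<in> C" "x \<in> C \<Longrightarrow> y \<in> C \<Longrightarrow> x + y \<in> C" "x \<in> C \<Longrightarrow> c *s x \<in> C"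
  using assms unfolding z4_code_iff by simp_all

lemma z4_code_even_on:
  assumes C: "z4_code C"
  shows "z4_code (even_on A C)"
  unfolding z4_code_iff
proof (intro conjI ballI allI)
  show "0 \<in> even_on A C"
    using z4_codeD(1)[OF C] by (simp add: even_on_def odd_supp_def)
  show "x + y \<in> even_on A C" if "x \<in> even_on A C" "y \<in> even_on A C" for x y
  proof -
    have "x + y \<in> C" using that z4_codeD(2)[OF C] by (simp add: even_on_def)
    then show ?thesis using that by (auto simp: even_on_def odd_supp_add)
  qed
  show "c *s x \<in> even_on A C" if "x \<in> even_on A C" for c x
  proof -
    have "c *s x \<in> C" using that z4_codeD(3)[OF C] by (simp add: even_on_def)
    then show ?thesis using that odd_supp_scale[of c x] by (auto simp: even_on_def)
  qed
qed

text \<open>Translation by a word of sign -1 permutes \<open>C\<close> and negates the sum.\<close>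

lemma sum_z4_char_eq_0:
  assumes C: "z4_code C" and "\<not> (\<forall>y\<in>C. z4_char g y = 1)"
  shows "(\<Sum>y\<in>C. z4_char g y) = 0"
proof -
  obtain y0 where y0: "y0 \<in> C" "z4_char g y0 = - 1"
    using assms(2) z4_char_cases by blast
  have neg: "- y0 \<in> C"
    using z4_codeD(3)[OF C y0(1), of "-1"] by (simp add: vector_sneg_minus1[symmetric])
  have "(\<Sum>y\<in>C. z4_char g y) = (\<Sum>y\<in>C. z4_char g (y + y0))"
  proof (rule sum.reindex_bij_witness[of _ "\<lambda>y. y + y0" "\<lambda>y. y + - y0"])
    show "y + - y0 \<in> C" if "y \<in> C" for y
      using that neg by (rule z4_codeD(2)[OF C])
    show "y + y0 \<in> C" if "y \<in> C" for y
      using that y0(1) by (rule z4_codeD(2)[OF C])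
  qed simp_all
  also have "\<dots> = - (\<Sum>y\<in>C. z4_char g y)"
    by (simp add: z4_char_add_right y0 sum_negf)
  finally show ?thesis by simp
qed

text \<open>
  A parity functional on \<open>C\<close> that vanishes on the words even on \<open>A\<close> is read off from the
  coordinates in \<open>A\<close>; over \<open>\<F>\<^sub>2\<close> this says that puncturing is dual to shortening.
\<close>

lemma z4_char_extend:
  fixes C :: "(z4 ^ 'n::finite) set"
  assumes C: "z4_code C" and triv: "\<forall>y\<in>even_on A C. z4_char g y = 1"
  shows "\<exists>h. (\<forall>i. i \<notin> A \<longrightarrow> h $ i = 0) \<and> (\<forall>y\<in>C. z4_char (g + h) y = 1)"
  using finite[of A] triv
proof (induction A arbitrary: g rule: finite_induct)
  case empty
  then show ?case by (intro exI[of _ 0]) (simp add: even_on_def)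
next
  case (insert a A)
  show ?case
  proof (cases "\<forall>y\<in>even_on A C. z4_char g y = 1")
    case True
    then show ?thesis using insert.IH[of g] by blast
  next
    case False
    then obtain y0 where y0: "y0 \<in> even_on A C" "z4_char g y0 = - 1"
      using z4_char_cases by blast
    then have a0: "a \<in> odd_supp y0"
      using insert.prems by (fastforce simp: even_on_def)
    \<comment> \<open>Among the words even on \<open>A\<close>, exactly those odd at
      \<open>a\<close> have sign -1 under \<open>g\<close>, because adding \<open>y0\<close> makes
      them even at \<open>a\<close>. The extra coordinate \<open>a\<close> flips just these
      signs.\<close>
    have "z4_char (g + axis a 1) y = 1" if y: "y \<in> even_on A C" for y
    proof (cases "a \<in> odd_supp y")
      case True
      have "y + y0 \<in> even_on A C"
        using y y0 z4_codeD(2)[OF z4_code_even_on[OF C]] by blast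
      then have "y + y0 \<in> even_on (insert a A) C"
        using True a0 by (auto simp: even_on_def odd_supp_add)
      then have "z4_char g y = - 1"
        using insert.prems y0(2) z4_char_add_right[of g y y0] by fastforce
      then show ?thesis using True by (simp add: z4_char_add_left z4_char_axis)
    next
      case False
      then have "y \<in> even_on (insert a A) C"
        using y by (auto simp: even_on_def)
      then show ?thesis using False insert.prems by (simp add: z4_char_add_left z4_char_axis)
    qed
    then obtain h where h: "\<forall>i. i \<notin> A \<longrightarrow> h $ i = 0" "\<forall>y\<in>C. z4_char (g + axis a 1 + h) y = 1"
      using insert.IH[of "g + axis a 1"] by blast
    then show ?thesis
      by (intro exI[of _ "axis a 1 + h"]) (auto simp: axis_def add.assoc)
  qed
qed

section \<open>Consequences of self-duality: doubled words, weights, translates\<close>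

lemma self_dual_code: "self_dual C \<Longrightarrow> z4_code C"
  unfolding self_dual_def by (rule conjunct1)

lemma self_dual_mem_iff: "self_dual C \<Longrightarrow> x \<in> C \<longleftrightarrow> (\<forall>y\<in>C. scalar_product x y = 0)"
proof -
  assume "self_dual C"
  then have "C = dual_code C" unfolding self_dual_def by (rule conjunct2)
  then have "x \<in> C \<longleftrightarrow> x \<in> dual_code C" by (rule arg_cong[where f = "\<lambda>A. x \<in> A"])
  then show ?thesis by (simp add: dual_code_def)
qed

text \<open>Twice a scalar product vanishes in \<open>z4\<close> exactly when that product is
  even.\<close>

lemma self_dual_double_mem_iff:
  assumes "self_dual C"
  shows "2 *s g \<in> C \<longleftrightarrow> (\<forall>y\<in>C. z4_char g y = 1)"
  unfolding self_dual_mem_iff[OF assms, of "2 *s g"]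
  by (simp add: scalar_product_scale_left z4_char_def z4_sign_def)

lemma card_odd_supp: "card (odd_supp x) = num_comps 1 x + num_comps 3 (x :: z4 ^ 'n::finite)"
proof -
  have "odd_supp x = {i. x $ i = 1} \<union> {i. x $ i = 3}"
  proof -
    have "\<forall>a::z4. 2 * a \<noteq> 0 \<longleftrightarrow> a = 1 \<or> a = 3" unfolding z4_all by simp
    then show ?thesis by (auto simp: odd_supp_def)
  qed
  then show ?thesis
    unfolding num_comps_def by (simp only:) (rule card_Un_disjoint, auto)
qed

lemma lee_weight_eq: "lee_weight x = card (odd_supp x) + 2 * num_comps 2 x"
  by (simp add: lee_weight_def card_odd_supp)

lemma euclidean_weight_eq: "euclidean_weight x = card (odd_supp x) + 4 * num_comps 2 x"
  by (simp add: euclidean_weight_def card_odd_supp)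

lemma scalar_product_self: "scalar_product x x = of_nat (card (odd_supp x))"
proof -
  have "\<forall>a::z4. a * a = (if 2 * a \<noteq> 0 then 1 else 0)" unfolding z4_all by simp
  then have "scalar_product x x = (\<Sum>i\<in>UNIV. if i \<in> odd_supp x then 1 else 0)"
    unfolding scalar_product_def odd_supp_def by (intro sum.cong) auto
  then show ?thesis by (simp add: sum.If_cases)
qed

lemma self_dual_dvd_card_odd_supp:
  assumes "self_dual C" "x \<in> C"
  shows "4 dvd card (odd_supp x)"
proof -
  have "scalar_product x x = 0" using assms self_dual_mem_iff by blast
  then show ?thesis by (simp add: scalar_product_self of_nat_z4_eq_0_iff)
qed

lemma num_comps_double: "num_comps 2 (2 *s x) = card (odd_supp x)"
proof -
  have "\<forall>a::z4. 2 * a = 2 \<longleftrightarrow> 2 * a \<noteq> 0" unfolding z4_all by simp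
  then show ?thesis unfolding num_comps_def odd_supp_def by simp
qed

text \<open>By \<open>z4_char_extend\<close>, some \<open>h\<close> supported on the odd positions
  of \<open>x\<close> turns \<open>twos x + g\<close> into a functional that is even on all of
  \<open>C\<close>, so its double lies in \<open>C\<close>. Adding this double to \<open>x\<close>
  keeps all parities and, off the odd positions, replaces the 2s of \<open>x\<close> by
  \<open>2 * g\<close>.\<close>

lemma twos_translate:
  assumes "self_dual C" "x \<in> C" "\<forall>y\<in>even_on (odd_supp x) C. z4_char (twos x + g) y = 1"
  shows "\<exists>z\<in>C. odd_supp z = odd_supp x \<and> (\<forall>i. i \<notin> odd_supp x \<longrightarrow> z $ i = 2 * g $ i)"
proof -
  have C: "z4_code C" using assms(1) by (rule self_dual_code)
  obtain h where h: "\<forall>i. i \<notin> odd_supp x \<longrightarrow> h $ i = 0"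
      "\<forall>y\<in>C. z4_char (twos x + g + h) y = 1"
    using z4_char_extend[OF C assms(3)] by blast
  define z where "z = x + 2 *s (twos x + g + h)"
  have "z \<in> C"
    unfolding z_def
    by (rule z4_codeD(2)[OF C assms(2)]) (use h(2) in \<open>simp only: self_dual_double_mem_iff[OF assms(1)]\<close>)
  moreover have "odd_supp z = odd_supp x"
    by (simp add: z_def odd_supp_add)
  moreover have "z $ i = 2 * g $ i" if "i \<notin> odd_supp x" for i
  proof -
    have "\<forall>a::z4. 2 * a = 0 \<longrightarrow> a + 2 * (if a = 2 then 1 else 0) = 0" unfolding z4_all by simp
    then have "x $ i + 2 * twos x $ i = 0" using that by (simp add: odd_supp_def twos_def)
    then show ?thesis using that h(1) by (simp add: z_def distrib_left add.assoc[symmetric])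
  qed
  ultimately show ?thesis by blast
qed

lemma num_comps_2_outside: "num_comps 2 z = card {i. i \<notin> odd_supp z \<and> z $ i = 2}"
  unfolding num_comps_def by (rule arg_cong[of _ _ card]) (auto simp: odd_supp_def)

text \<open>With disjoint odd positions, \<open>x $ i * y $ i\<close> is 2 where one entry is 2 and
  the other odd, and 0 elsewhere. So \<open>scalar_product x y\<close> is twice the sum of the two
  pairings, and orthogonality gives these the same parity.\<close>

lemma twos_char_commute:
  assumes "self_dual C" "x \<in> C" "y \<in> C" "odd_supp x \<inter> odd_supp y = {}"
  shows "z4_char (twos x) y = z4_char (twos y) x"
proof -
  have *: "\<forall>a b::z4. 2 * a = 0 \<or> 2 * b = 0 \<longrightarrow>
      a * b = 2 * ((if a = 2 then 1 else 0) * b + (if b = 2 then 1 else 0) * a)"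
    unfolding z4_all by simp
  have "x $ i * y $ i = 2 * (twos x $ i * y $ i + twos y $ i * x $ i)" for i
  proof -
    have "2 * x $ i = 0 \<or> 2 * y $ i = 0" using assms(4) by (auto simp: odd_supp_def)
    then show ?thesis using *[rule_format, of "x $ i" "y $ i"] by (simp only: twos_def vec_lambda_beta)
  qed
  then have "scalar_product x y = 2 * (scalar_product (twos x) y + scalar_product (twos y) x)"
    by (simp add: scalar_product_def sum.distrib sum_distrib_left)
  moreover have "scalar_product x y = 0"
    using assms(1-3) self_dual_mem_iff by blast
  ultimately have "z4_sign (scalar_product (twos x) y + scalar_product (twos y) x) = 1"
    by (simp add: z4_sign_def)
  then have "z4_char (twos x) y * z4_char (twos y) x = 1"
    by (simp add: z4_char_def z4_sign_add)
  then show ?thesis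
    using z4_char_cases[of "twos x" y] z4_char_cases[of "twos y" x] by auto
qed

section \<open>Character sums over self-dual codes\<close>

lemma sum_char_axis:
  "(\<Sum>i\<in>A. z4_char (axis i 1) y) = int (card A) - 2 * int (card (A \<inter> odd_supp y))"
  for A :: "'n::finite set"
proof -
  have "(\<Sum>i\<in>A. z4_char (axis i 1) y) = (\<Sum>i\<in>A. 1 - 2 * of_bool (i \<in> odd_supp y))"
    by (rule sum.cong) (auto simp: z4_char_axis)
  also have "\<dots> = int (card A) - 2 * int (card (A \<inter> odd_supp y))"
    by (simp add: sum_subtractf sum_distrib_left[symmetric] Int_def)
  finally show ?thesis .
qed

lemma z4_char_eq_1: "odd_supp y = {} \<Longrightarrow> z4_char g y = 1"
proof -
  assume "odd_supp y = {}"
  then have "2 * (g $ i * y $ i) = 0" for i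
    by (subst mult.left_commute) (simp add: odd_supp_def)
  then have "2 * scalar_product g y = 0"
    unfolding scalar_product_def sum_distrib_left by (intro sum.neutral) simp
  then show ?thesis by (simp add: z4_char_def z4_sign_def)
qed

text \<open>The square expands into characters indexed by pairs of positions. For distinct positions
  the doubled word has Lee weight 4 and is no codeword, so the character is nontrivial and sums to
  0; only the diagonal remains.\<close>

lemma self_dual_second_moment:
  fixes C :: "(z4 ^ 'n::finite) set"
  assumes sd: "self_dual C" and lee: "\<And>x. x \<in> C \<Longrightarrow> x \<noteq> 0 \<Longrightarrow> 4 < lee_weight x"
  shows "(\<Sum>y\<in>C. (int CARD('n) - 2 * int (card (odd_supp y)))\<^sup>2) = int CARD('n) * int (card C)"
proof -
  have C: "z4_code C" using sd by (rule self_dual_code)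
  have sum2: "(\<Sum>y\<in>C. z4_char (axis i 1 + axis j 1) y) = (if i = j then int (card C) else 0)"
    for i j :: 'n
  proof (cases "i = j")
    case True
    have "z4_char (axis i 1 + axis i 1) y = 1" for y :: "z4 ^ 'n"
      by (simp only: z4_char_add_left z4_char_axis) simp
    then show ?thesis using True by (simp only:) simp
  next
    case False
    define g :: "z4 ^ 'n" where "g = axis i 1 + axis j 1"
    have "odd_supp g = {i, j}" using False by (auto simp: g_def odd_supp_add)
    then have two: "num_comps 2 (2 *s g) = 2" using False by (simp add: num_comps_double)
    have "2 *s g \<noteq> 0"
    proof
      assume "2 *s g = 0"
      then show False using two by (simp add: num_comps_def)
    qed
    moreover have "lee_weight (2 *s g) = 4" using two by (simp add: lee_weight_eq)
    ultimately have "2 *s g \<notin> C" using lee by fastforce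
    then show ?thesis
      using False sum_z4_char_eq_0[OF C, of g] self_dual_double_mem_iff[OF sd, of g]
      by (simp add: g_def[symmetric])
  qed
  have "(\<Sum>y\<in>C. (int CARD('n) - 2 * int (card (odd_supp y)))\<^sup>2)
      = (\<Sum>y\<in>C. (\<Sum>i\<in>UNIV. z4_char (axis i 1) y)\<^sup>2)"
    by (simp add: sum_char_axis)
  also have "\<dots> = (\<Sum>y\<in>C. \<Sum>i\<in>UNIV. \<Sum>j\<in>UNIV. z4_char (axis i 1 + axis j 1) y)"
    by (simp add: power2_eq_square sum_product z4_char_add_left)
  also have "\<dots> = (\<Sum>i\<in>UNIV. \<Sum>j\<in>UNIV. \<Sum>y\<in>C. z4_char (axis i 1 + axis j 1) y)"
    by (subst sum.swap, rule sum.cong[OF refl], rule sum.swap)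
  also have "\<dots> = int CARD('n) * int (card C)"
    by (simp add: sum2)
  finally show ?thesis .
qed

text \<open>A trivial character would let \<open>twos_translate\<close> with \<open>g = 0\<close>
  remove all 2s from \<open>x\<close>.\<close>

lemma sum_char_twos_eq_0:
  assumes sd: "self_dual C" and x: "x \<in> C"
    and none: "\<And>z. z \<in> C \<Longrightarrow> odd_supp z = odd_supp x \<Longrightarrow> num_comps 2 z \<noteq> 0"
  shows "(\<Sum>d\<in>even_on (odd_supp x) C. z4_char (twos x) d) = 0"
proof -
  have "\<not> (\<forall>d\<in>even_on (odd_supp x) C. z4_char (twos x) d = 1)"
  proof
    assume "\<forall>d\<in>even_on (odd_supp x) C. z4_char (twos x) d = 1"
    then obtain z where z: "z \<in> C" "odd_supp z = odd_supp x"
        "\<forall>i. i \<notin> odd_supp x \<longrightarrow> z $ i = 2 * (0 :: z4 ^ _) $ i"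
      using twos_translate[OF sd x, of 0] by auto
    then have "{i. i \<notin> odd_supp z \<and> z $ i = 2} = {}" by auto
    then have "num_comps 2 z = 0" by (simp only: num_comps_2_outside card.empty)
    then show False using none z by blast
  qed
  then show ?thesis
    by (rule sum_z4_char_eq_0[OF z4_code_even_on[OF self_dual_code[OF sd]]])
qed

text \<open>The weight is the sum of the coordinate signs of \<open>d\<close> over the positions
  \<open>i\<close> where \<open>x\<close> is even. Each \<open>i\<close> contributes 0, since
  otherwise \<open>twos_translate\<close> would give a codeword whose only 2 is at
  \<open>i\<close>.\<close>

lemma sum_char_twos_weighted_eq_0:
  fixes x :: "z4 ^ 'n::finite"
  assumes sd: "self_dual C" and x: "x \<in> C"
    and none: "\<And>z. z \<in> C \<Longrightarrow> odd_supp z = odd_supp x \<Longrightarrow> num_comps 2 z \<noteq> 1"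
  shows "(\<Sum>d\<in>even_on (odd_supp x) C. z4_char (twos x) d *
      (int CARD('n) - int (card (odd_supp x)) - 2 * int (card (odd_supp d)))) = 0"
proof -
  let ?D = "even_on (odd_supp x) C"
  have zero: "(\<Sum>d\<in>?D. z4_char (twos x + axis i 1) d) = 0" if i: "i \<in> - odd_supp x" for i
  proof -
    have "\<not> (\<forall>d\<in>?D. z4_char (twos x + axis i 1) d = 1)"
    proof
      assume "\<forall>d\<in>?D. z4_char (twos x + axis i 1) d = 1"
      then obtain z where z: "z \<in> C" "odd_supp z = odd_supp x"
          "\<forall>j. j \<notin> odd_supp x \<longrightarrow> z $ j = 2 * axis i 1 $ j"
        using twos_translate[OF sd x] by blast
      then have "z $ j = (if j = i then 2 else 0)" if "j \<notin> odd_supp x" for j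
        using that by (simp add: axis_def)
      then have "{j. j \<notin> odd_supp z \<and> z $ j = 2} = {i}"
        using i z(2) by (auto split: if_splits)
      then have "num_comps 2 z = 1" by (simp add: num_comps_2_outside)
      then show False using none z by blast
    qed
    then show ?thesis
      by (rule sum_z4_char_eq_0[OF z4_code_even_on[OF self_dual_code[OF sd]]])
  qed
  have "(\<Sum>d\<in>?D. z4_char (twos x) d *
      (int CARD('n) - int (card (odd_supp x)) - 2 * int (card (odd_supp d))))
    = (\<Sum>d\<in>?D. \<Sum>i\<in>- odd_supp x. z4_char (twos x + axis i 1) d)"
  proof (rule sum.cong[OF refl])
    fix d assume "d \<in> ?D"
    then have "- odd_supp x \<inter> odd_supp d = odd_supp d" by (auto simp: even_on_def)
    moreover have "int (card (- odd_supp x)) = int CARD('n) - int (card (odd_supp x))"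
      by (simp add: Compl_eq_Diff_UNIV card_Diff_subset of_nat_diff card_mono)
    ultimately have "(\<Sum>i\<in>- odd_supp x. z4_char (axis i 1) d)
        = int CARD('n) - int (card (odd_supp x)) - 2 * int (card (odd_supp d))"
      by (simp add: sum_char_axis)
    then show "z4_char (twos x) d *
        (int CARD('n) - int (card (odd_supp x)) - 2 * int (card (odd_supp d)))
      = (\<Sum>i\<in>- odd_supp x. z4_char (twos x + axis i 1) d)"
      by (simp add: z4_char_add_left sum_distrib_left[symmetric])
  qed
  also have "\<dots> = (\<Sum>i\<in>- odd_supp x. \<Sum>d\<in>?D. z4_char (twos x + axis i 1) d)"
    by (rule sum.swap)
  finally show ?thesis using zero by simp
qed

section \<open>Length 24 with minimum Lee weight 10\<close>

lemma card_odd_supp_values: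
  fixes C :: "(z4 ^ 24) set"
  assumes sd: "self_dual C" and lee: "\<And>x. x \<in> C \<Longrightarrow> x \<noteq> 0 \<Longrightarrow> 10 \<le> lee_weight x"
    and y: "y \<in> C"
  shows "card (odd_supp y) \<in> {0, 8, 12, 16, 20, 24}"
proof -
  have le: "card (odd_supp y) \<le> 24"
    using card_mono[OF finite subset_UNIV, of "odd_supp y"] by simp
  have "8 \<le> card (odd_supp y)" if nz: "card (odd_supp y) \<noteq> 0"
  proof -
    have "2 *s y \<in> C" using y z4_codeD(3)[OF self_dual_code[OF sd]] by blast
    moreover have "2 *s y \<noteq> 0"
      using nz by (auto simp: odd_supp_def vec_eq_iff)
    ultimately have "10 \<le> 2 * card (odd_supp y)"
      using lee[of "2 *s y"] by (simp add: lee_weight_eq num_comps_double)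
    then show ?thesis using self_dual_dvd_card_odd_supp[OF sd y] by presburger
  qed
  then show ?thesis
    unfolding insert_iff empty_iff using le self_dual_dvd_card_odd_supp[OF sd y] by presburger
qed

lemma exists_euclidean_weight_12:
  fixes C :: "(z4 ^ 24) set"
  assumes sd: "self_dual C" and lee: "\<And>x. x \<in> C \<Longrightarrow> x \<noteq> 0 \<Longrightarrow> 10 \<le> lee_weight x"
    and not_full: "\<And>x. x \<in> C \<Longrightarrow> card (odd_supp x) \<noteq> 24"
  shows "\<exists>z\<in>C. euclidean_weight z = 12"
proof (rule ccontr)
  assume "\<not> ?thesis"
  then have none: "card (odd_supp z) + 4 * num_comps 2 z \<noteq> 12" if "z \<in> C" for z
    using that by (auto simp: euclidean_weight_eq)
  have C: "z4_code C" using sd by (rule self_dual_code)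
  have vals: "card (odd_supp y) \<in> {0, 8, 12, 16, 20}" if "y \<in> C" for y
    using card_odd_supp_values[OF sd lee that] not_full[OF that] by auto
  have card_add: "card (odd_supp (x + d)) = card (odd_supp x) + card (odd_supp d)"
    if "odd_supp x \<inter> odd_supp d = {}" for x d :: "z4 ^ 24"
  proof -
    have "odd_supp (x + d) = odd_supp x \<union> odd_supp d" using that by (auto simp: odd_supp_add)
    then show ?thesis using that by (simp add: card_Un_disjoint)
  qed
  define X where "X k = {y \<in> C. card (odd_supp y) = k}" for k
  \<comment> \<open>Extending by 0 turns the sums over \<open>even_on\<close> into sums over all of
    \<open>C\<close> and makes the kernel symmetric.\<close>
  define e where "e x d = (if odd_supp x \<inter> odd_supp d = {} then z4_char (twos x) d else 0)"
    for x d :: "z4 ^ 24"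
  have e_sym: "e x d = e d x" if "x \<in> C" "d \<in> C" for x d
    using twos_char_commute[OF sd that] by (auto simp: e_def Int_commute)
  have filter: "(\<Sum>d\<in>even_on (odd_supp x) C. z4_char (twos x) d * f d) = (\<Sum>d\<in>C. e x d * f d)"
    for x f
  proof -
    have "even_on (odd_supp x) C = {d \<in> C. odd_supp x \<inter> odd_supp d = {}}"
      by (auto simp: even_on_def)
    then show ?thesis
      by (simp add: sum.inter_filter e_def if_distrib[of "\<lambda>t. t * _"] cong: if_cong)
  qed
  have split: "(\<Sum>d\<in>C. a * of_bool (card (odd_supp d) = 0) + b * (of_bool (card (odd_supp d) = k) * e x d))
      = a * int (card (X 0)) + b * (\<Sum>d\<in>X k. e x d)" for a b x k
  proof -
    have "X j = {d \<in> C. card (odd_supp d) = j}" for j by (simp add: X_def)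
    moreover have "(\<Sum>d\<in>C. of_bool (card (odd_supp d) = k) * e x d) = (\<Sum>d\<in>X k. e x d)"
      by (simp add: X_def sum.inter_filter of_bool_def if_distrib[of "\<lambda>t. t * _"] cong: if_cong)
    moreover have "(\<Sum>d\<in>C. of_bool (card (odd_supp d) = 0)) = int (card (X 0))"
      by (simp add: X_def Int_def)
    ultimately show ?thesis by (simp only: sum.distrib sum_distrib_left[symmetric])
  qed
  have X8: "(\<Sum>w\<in>X 12. e x w) = 2 * int (card (X 0))" if "x \<in> X 8" for x
  proof -
    have x: "x \<in> C" "card (odd_supp x) = 8" using that by (auto simp: X_def)
    \<comment> \<open>Here 16 = 24 - 8. If \<open>d\<close> had 16 or 20 odd entries,
      \<open>x + d\<close> would have 24 or 28, so 0, 8 and 12 remain, with weights 16, 0 and -8: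
      the weight is chosen so that 8 drops out.\<close>
    have "e x d * (16 - 2 * int (card (odd_supp d)))
        = 16 * of_bool (card (odd_supp d) = 0) + (- 8) * (of_bool (card (odd_supp d) = 12) * e x d)"
      if d: "d \<in> C" for d
    proof (cases "odd_supp x \<inter> odd_supp d = {}")
      case True
      then have "card (odd_supp d) \<in> {0, 8, 12}"
        using vals[OF d] vals[of "x + d"] card_add[OF True] z4_codeD(2)[OF C x(1) d] x(2) by auto
      then show ?thesis using True by (auto simp: e_def z4_char_eq_1)
    qed (auto simp: e_def)
    then have "(\<Sum>d\<in>C. e x d * (16 - 2 * int (card (odd_supp d))))
        = 16 * int (card (X 0)) + (- 8) * (\<Sum>d\<in>X 12. e x d)"
      unfolding split[symmetric] by (rule sum.cong[OF refl])
    moreover have "(\<Sum>d\<in>C. e x d * (16 - 2 * int (card (odd_supp d)))) = 0"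
      using sum_char_twos_weighted_eq_0[OF sd x(1)] none x(2) by (fastforce simp: filter)
    ultimately show ?thesis by simp
  qed
  have X12: "(\<Sum>w\<in>X 8. e x w) = - int (card (X 0))" if "x \<in> X 12" for x
  proof -
    have x: "x \<in> C" "card (odd_supp x) = 12" using that by (auto simp: X_def)
    \<comment> \<open>Twelve or more odd entries in \<open>d\<close> would give \<open>x + d\<close>
      at least 24, so only 0 and 8 remain.\<close>
    have "e x d * 1
        = 1 * of_bool (card (odd_supp d) = 0) + 1 * (of_bool (card (odd_supp d) = 8) * e x d)"
      if d: "d \<in> C" for d
    proof (cases "odd_supp x \<inter> odd_supp d = {}")
      case True
      then have "card (odd_supp d) \<in> {0, 8}"
        using vals[OF d] vals[of "x + d"] card_add[OF True] z4_codeD(2)[OF C x(1) d] x(2) by auto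
      then show ?thesis using True by (auto simp: e_def z4_char_eq_1)
    qed (auto simp: e_def)
    then have "(\<Sum>d\<in>C. e x d * 1) = 1 * int (card (X 0)) + 1 * (\<Sum>d\<in>X 8. e x d)"
      unfolding split[symmetric] by (rule sum.cong[OF refl])
    moreover have "(\<Sum>d\<in>C. e x d * 1) = 0"
      using sum_char_twos_eq_0[OF sd x(1)] none x(2) filter[of x "\<lambda>_. 1"] by fastforce
    ultimately show ?thesis by simp
  qed
  have "(\<Sum>x\<in>X 8. \<Sum>w\<in>X 12. e x w) = (\<Sum>w\<in>X 12. \<Sum>x\<in>X 8. e w x)"
    by (subst sum.swap) (auto intro!: sum.cong e_sym simp: X_def)
  then have "2 * int (card (X 0)) * int (card (X 8)) = - (int (card (X 0)) * int (card (X 12)))"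
    by (simp add: X8 X12 mult.commute)
  \<comment> \<open>Opposite signs on the two sides force both products of cardinalities to
    vanish.\<close>
  then have "int (2 * card (X 0) * card (X 8) + card (X 0) * card (X 12)) = 0"
    unfolding of_nat_add of_nat_mult of_nat_numeral by linarith
  then have "2 * card (X 0) * card (X 8) + card (X 0) * card (X 12) = 0"
    by (simp only: of_nat_eq_0_iff)
  moreover have "0 \<in> X 0"
    using z4_codeD(1)[OF C] by (simp add: X_def odd_supp_def)
  then have "card (X 0) \<noteq> 0" by auto
  ultimately have "X 12 = {}" by auto
  \<comment> \<open>Without 12 odd entries the base is 24, 8, -8 or -16, so each square is at least
    64.\<close>
  have "24 < (24 - 2 * int (card (odd_supp y)))\<^sup>2" if "y \<in> C" for y
    using vals[OF that] that \<open>X 12 = {}\<close> by (auto simp: X_def)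
  moreover have "C \<noteq> {}" using z4_codeD(1)[OF C] by auto
  ultimately have "(\<Sum>y\<in>C. 24) < (\<Sum>y\<in>C. (24 - 2 * int (card (odd_supp y)))\<^sup>2)"
    by (intro sum_strict_mono) auto
  moreover have "(\<Sum>y\<in>C. (24 - 2 * int (card (odd_supp y)))\<^sup>2) = 24 * int (card C)"
  proof -
    have "4 < lee_weight x" if "x \<in> C" "x \<noteq> 0" for x
      using lee[OF that] by simp
    then show ?thesis using self_dual_second_moment[OF sd] by simp
  qed
  ultimately show False by simp
qed

theorem proposition4p1:
  fixes C :: "(z4 ^ 24) set"
  assumes "self_dual C"
    and "min_lee_weight C = 10"
  shows "type_I C \<and> min_euclidean_weight C = 12"
proof -
  have sd: "self_dual C" by fact
  have C: "z4_code C" using sd by (rule self_dual_code)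
  \<comment> \<open>The dual of the zero code is the whole space. A nonzero codeword ensures that
    the minimum Lee weight is attained.\<close>
  have "C \<noteq> {0}"
  proof
    assume "C = {0}"
    then have "axis 0 1 \<in> C"
      unfolding self_dual_mem_iff[OF sd, of "axis 0 1"] by (simp add: scalar_product_def)
    then show False using \<open>C = {0}\<close> by (simp add: axis_eq_0_iff)
  qed
  then have ne: "C - {0} \<noteq> {}" using z4_codeD(1)[OF C] by blast
  have lee: "10 \<le> lee_weight x" if "x \<in> C" "x \<noteq> 0" for x
    using assms(2) Min_le[of "lee_weight ` (C - {0})" "lee_weight x"] that
    by (simp add: min_lee_weight_def)
  have "10 \<in> lee_weight ` (C - {0})"
    using assms(2) Min_in[of "lee_weight ` (C - {0})"] ne by (simp add: min_lee_weight_def)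
  then obtain u where u: "u \<in> C" "card (odd_supp u) + 2 * num_comps 2 u = 10"
    unfolding lee_weight_eq by fastforce
  then have u_cases: "card (odd_supp u) = 8 \<and> num_comps 2 u = 1 \<or>
      card (odd_supp u) = 0 \<and> num_comps 2 u = 5"
    using card_odd_supp_values[OF sd lee u(1)] by auto
  have "\<exists>z\<in>C. euclidean_weight z = 12"
    using u_cases
  proof
    assume "card (odd_supp u) = 8 \<and> num_comps 2 u = 1"
    then show ?thesis using u(1) by (intro bexI[of _ u]) (simp_all add: euclidean_weight_eq)
  next
    assume u5: "card (odd_supp u) = 0 \<and> num_comps 2 u = 5"
    have "card (odd_supp y) \<noteq> 24" if y: "y \<in> C" for y
    proof
      assume "card (odd_supp y) = 24"
      then have full: "odd_supp y = UNIV"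
        using card_subset_eq[of UNIV "odd_supp y"] by simp
      \<comment> \<open>Against odd entries each 2 of \<open>u\<close> contributes 2, so five of
        them give 5 * 2 = 2 in \<open>z4\<close>, contrary to orthogonality.\<close>
      have mult: "\<forall>a b::z4. 2 * a = 0 \<longrightarrow> 2 * b \<noteq> 0 \<longrightarrow> a * b = (if a = 2 then 2 else 0)"
        unfolding z4_all by simp
      have "u $ i * y $ i = (if u $ i = 2 then 2 else 0)" for i
      proof (rule mult[rule_format])
        have "i \<notin> odd_supp u" using u5 by simp
        then show "2 * u $ i = 0" by (simp add: odd_supp_def)
        have "i \<in> odd_supp y" using full by simp
        then show "2 * y $ i \<noteq> 0" by (simp add: odd_supp_def)
      qed
      then have "scalar_product u y = (\<Sum>i\<in>UNIV. if u $ i = 2 then 2 else 0)"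
        by (simp only: scalar_product_def)
      also have "\<dots> = of_nat (num_comps 2 u) * 2"
        by (simp add: num_comps_def sum.If_cases)
      finally show False
        using u5 u(1) y self_dual_mem_iff[OF sd, of u] by simp
    qed
    then show ?thesis using exists_euclidean_weight_12[OF sd lee] by blast
  qed
  then obtain z where z: "z \<in> C" "euclidean_weight z = 12" by blast
  have "type_I C"
    using sd z by (auto simp: type_I_def type_II_def intro!: bexI[of _ z])
  moreover have "12 \<le> euclidean_weight x" if "x \<in> C" "x \<noteq> 0" for x
  proof -
    \<comment> \<open>The Euclidean weight dominates the Lee weight, and the first multiple of 4
      from 10 on is 12.\<close>
    have "10 \<le> euclidean_weight x"
      using lee[OF that] by (simp add: lee_weight_eq euclidean_weight_eq)
    moreover have "4 dvd euclidean_weight x"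
      using self_dual_dvd_card_odd_supp[OF sd that(1)] by (simp add: euclidean_weight_eq)
    ultimately show ?thesis by presburger
  qed
  moreover have "z \<noteq> 0"
    using z(2) by (auto simp: euclidean_weight_def num_comps_def)
  ultimately show ?thesis
    unfolding min_euclidean_weight_def
    using z by (auto intro!: Min_eqI)
qed

end
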